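(* (Leaf recurrence) Let $H$ be a graph, and let $v_1$ and $v_2$ be distinct vertices of $H$. Let $G$ be the graph obtained from $H$ by adding pendant edges $\overline{v_1v_1'}$ and $\overline{v_2v_2'}$ (so $v_1'$ and $v_2'$ are leaves in $G$). Let $G_1$ be the graph obtained from $H$ by adding a pendant edge $\overline{v_1v_1'}$ and an edge $\overline{v_1v_2}$, and let $G_2$ be the graph obtained from $H$ by adding a pendant edge $\overline{v_2v_2'}$ and an edge $\overline{v_1v_2}$. Suppose that $G$, $G_1$ and $G_2$ are bipartite, so that $V(G)$, $V(G_1)$ and $V(G_2)$ are defined. Then $V(G)=V(G_1)+V(G_2)$.
   Context: For a graph $G=(V,E)$ with $n=|E|$ edges, the matching polytope $M_G$ is the set of all nonnegative edge weightings $w\colon E\to\mathbf R_{\ge 0}$ such that $\sum_{e\ni v}w(e)\le 1$ for all $v\in V$; it is a full-dimensional polytope in $\mathbf R^n$. When $G$ is bipartite, $M_G$ is a lattice polytope, and its normalized volume is the integer $V(G)=n!\cdot\operatorname{vol}(M_G)$. *)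

theory Defs
  imports "HOL-Analysis.Analysis"
begin

text \<open>
  Edges are named, so that parallel edges are allowed: the edge \<open>v1 v2\<close> may be added to a graph
  that already has an edge joining \<open>v1\<close> and \<open>v2\<close>. A simple graph is the case where \<open>ends\<close> is
  injective on \<open>edges\<close>. Loops are excluded, as they are in every bipartite graph.
\<close>

record ('v, 'e) graph =
  verts :: "'v set"
  edges :: "'e set"
  ends :: "'e \<Rightarrow> 'v set"

definition is_graph :: "('v, 'e) graph \<Rightarrow> bool" where
  "is_graph G \<longleftrightarrow> finite (verts G) \<and> finite (edges G) \<and>
     (\<forall>e\<in>edges G. ends G e \<subseteq> verts G \<and> card (ends G e) = 2)"

definition bipartite :: "('v, 'e) graph \<Rightarrow> bool" where
  "bipartite G \<longleftrightarrow> (\<exists>A B. A \<union> B = verts G \<and> A \<inter> B = {} \<and>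
     (\<forall>e\<in>edges G. \<exists>a\<in>A. \<exists>b\<in>B. ends G e = {a, b}))"

text \<open>
  The next two operations are meant for an edge name \<open>e\<close> that is not yet an edge of \<open>G\<close> and,
  for the pendant edge, a leaf \<open>v'\<close> that is not yet a vertex of \<open>G\<close>.
\<close>

definition add_edge :: "'e \<Rightarrow> 'v \<Rightarrow> 'v \<Rightarrow> ('v, 'e) graph \<Rightarrow> ('v, 'e) graph" where
  "add_edge e u v G = G\<lparr>edges := insert e (edges G), ends := (ends G)(e := {u, v})\<rparr>"

definition add_pendant_edge :: "'e \<Rightarrow> 'v \<Rightarrow> 'v \<Rightarrow> ('v, 'e) graph \<Rightarrow> ('v, 'e) graph" where
  "add_pendant_edge e v v' G = add_edge e v v' (G\<lparr>verts := insert v' (verts G)\<rparr>)"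

text \<open>
  The space of real edge weightings is the set of extensional functions on \<open>edges G\<close>, which is
  the space of the product measure \<open>\<Pi>\<^sub>M e\<in>edges G. lborel\<close>, i.e. Lebesgue measure with one
  coordinate for each edge.
\<close>

definition matching_polytope :: "('v, 'e) graph \<Rightarrow> ('e \<Rightarrow> real) set" where
  "matching_polytope G = {w \<in> edges G \<rightarrow>\<^sub>E {0..}.
     \<forall>v\<in>verts G. (\<Sum>e\<in>{e\<in>edges G. v \<in> ends G e}. w e) \<le> 1}"

definition normalized_volume :: "('v, 'e) graph \<Rightarrow> real" where
  "normalized_volume G =
     fact (card (edges G)) * measure (\<Pi>\<^sub>M e\<in>edges G. lborel) (matching_polytope G)"

end

theory Submission
  imports Defs
begin

text \<open>
  All three matching polytopes fiber over the matching polytope of \<open>H\<close>, the fiber being the set of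
  weights allowed on the two new edges. Given a point \<open>w\<close> of the polytope of \<open>H\<close>, let \<open>a\<close> and \<open>b\<close>
  be the capacities that \<open>w\<close> leaves unused at \<open>v\<^sub>1\<close> and \<open>v\<^sub>2\<close> (the lemmas call them slacks). The
  fibers are
    \<^item> the rectangle \<open>0 \<le> x \<le> a\<close>, \<open>0 \<le> y \<le> b\<close> for \<open>G\<close>,
    \<^item> the region \<open>0 \<le> z \<le> b\<close>, \<open>0 \<le> x \<le> a - z\<close> for \<open>G\<^sub>1\<close>,
    \<^item> the region \<open>0 \<le> z \<le> a\<close>, \<open>0 \<le> y \<le> b - z\<close> for \<open>G\<^sub>2\<close>,
  where \<open>x\<close>, \<open>y\<close> and \<open>z\<close> are the weights of the pendant edges at \<open>v\<^sub>1\<close> and \<open>v\<^sub>2\<close> and of the edge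
  \<open>v\<^sub>1 v\<^sub>2\<close> (\<open>fiber_two_pendant_edges\<close>, \<open>fiber_pendant_edge_and_edge\<close>).

  The diagonal \<open>x = y\<close> cuts the rectangle into the part with \<open>y \<le> x\<close> and the part with \<open>x \<le> y\<close>.
  The shear \<open>(x, z) \<mapsto> (x + z, z)\<close> carries the second region onto the first part, and
  \<open>(y, z) \<mapsto> (z, y + z)\<close> carries the third onto the other part. Shears preserve area, so the area of
  the rectangle is the sum of the other two areas (\<open>area_rectangle_eq_sheared_triangles\<close>).
  Integrating over \<open>w\<close> (\<open>emeasure_PiM_insert_insert\<close>) gives the same additivity for volumes, and
  the three graphs have equally many edges, hence the same normalizing factorial.
\<close>

section \<open>Slack and the addition of edges\<close>

definition slack :: "('v, 'e) graph \<Rightarrow> 'v \<Rightarrow> ('e \<Rightarrow> real) \<Rightarrow> real" where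
  "slack G v w = 1 - (\<Sum>e\<in>{e\<in>edges G. v \<in> ends G e}. w e)"

lemma matching_polytope_iff_slack:
  "w \<in> matching_polytope G \<longleftrightarrow>
     w \<in> edges G \<rightarrow>\<^sub>E {0..} \<and> (\<forall>v\<in>verts G. 0 \<le> slack G v w)"
  by (simp add: matching_polytope_def slack_def)

lemma slack_le_one:
  assumes "w \<in> edges G \<rightarrow>\<^sub>E {0..}"
  shows "slack G v w \<le> 1"
  unfolding slack_def using assms by (auto intro!: sum_nonneg simp: PiE_iff)

lemma edges_add_edge [simp]: "edges (add_edge e u v G) = insert e (edges G)"
  and verts_add_edge [simp]: "verts (add_edge e u v G) = verts G"
  and edges_add_pendant_edge [simp]: "edges (add_pendant_edge e v v' G) = insert e (edges G)"
  and verts_add_pendant_edge [simp]: "verts (add_pendant_edge e v v' G) = insert v' (verts G)"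
  by (simp_all add: add_edge_def add_pendant_edge_def)

lemma add_edge_commute: "add_edge e u v G = add_edge e v u G"
  by (simp add: add_edge_def insert_commute)

lemma is_graph_add_edge:
  assumes "is_graph G" "u \<in> verts G" "v \<in> verts G" "u \<noteq> v"
  shows "is_graph (add_edge e u v G)"
  using assms by (auto simp: is_graph_def add_edge_def)

lemma is_graph_add_pendant_edge:
  assumes "is_graph G" "v \<in> verts G" "v' \<notin> verts G"
  shows "is_graph (add_pendant_edge e v v' G)"
  using assms unfolding add_pendant_edge_def
  by (intro is_graph_add_edge) (auto simp: is_graph_def)

text \<open>
  A weight on a new edge is taken out of the slack of exactly its two end points, and membership in
  the polytope says that all weights and all slacks are nonnegative. These two facts reduce the
  fibers over the polytope of the smaller graph to inequalities between new weights and old slacks.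
\<close>
lemma slack_add_edge:
  assumes "finite (edges G)" "e \<notin> edges G"
  shows "slack (add_edge e u v G) z (w(e := x)) =
    slack G z w - (if z \<in> {u, v} then x else 0)"
proof -
  let ?S = "{d \<in> edges G. z \<in> ends G d}"
  have "{d \<in> edges (add_edge e u v G). z \<in> ends (add_edge e u v G) d} =
      (if z \<in> {u, v} then insert e ?S else ?S)"
    using assms(2) by (auto simp: add_edge_def)
  moreover have "(\<Sum>d\<in>?S. (w(e := x)) d) = (\<Sum>d\<in>?S. w d)"
    using assms(2) by (intro sum.cong) auto
  ultimately show ?thesis
    using assms by (simp add: slack_def)
qed

lemma slack_add_pendant_edge:
  assumes "finite (edges G)" "e \<notin> edges G" "z \<noteq> v'"
  shows "slack (add_pendant_edge e v v' G) z (w(e := x)) =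
    slack G z w - (if z = v then x else 0)"
proof -
  have "slack (G\<lparr>verts := V\<rparr>) z w = slack G z w" for V
    by (simp add: slack_def)
  then show ?thesis
    using assms unfolding add_pendant_edge_def by (subst slack_add_edge) auto
qed

lemma fun_upd_in_PiE_insert_iff:
  assumes "e \<notin> E" "w \<in> extensional E"
  shows "w(e := x) \<in> insert e E \<rightarrow>\<^sub>E A \<longleftrightarrow> w \<in> E \<rightarrow>\<^sub>E A \<and> x \<in> A"
  using assms by (auto simp: PiE_iff extensional_def)

lemma fun_upd_in_matching_polytope_add_edge_iff:
  assumes "finite (edges G)" "e \<notin> edges G" "u \<in> verts G" "v \<in> verts G"
    and "w \<in> extensional (edges G)"
  shows "w(e := x) \<in> matching_polytope (add_edge e u v G) \<longleftrightarrow>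
    w \<in> matching_polytope G \<and> 0 \<le> x \<and> x \<le> slack G u w \<and> x \<le> slack G v w"
  using assms
  by (force simp: matching_polytope_iff_slack slack_add_edge fun_upd_in_PiE_insert_iff)

text \<open>
  The leaf contributes no condition of its own: no old edge meets it, so its slack is \<open>1\<close>, and
  \<open>x \<le> 1\<close> follows from \<open>x \<le> slack G v w\<close>.
\<close>
lemma fun_upd_in_matching_polytope_add_pendant_edge_iff:
  assumes "is_graph G" "e \<notin> edges G" "v \<in> verts G" "v' \<notin> verts G"
    and "w \<in> extensional (edges G)"
  shows "w(e := x) \<in> matching_polytope (add_pendant_edge e v v' G) \<longleftrightarrow>
    w \<in> matching_polytope G \<and> 0 \<le> x \<and> x \<le> slack G v w"
proof -
  let ?G' = "G\<lparr>verts := insert v' (verts G)\<rparr>"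
  have fin: "finite (edges G)" and no_edge: "{d \<in> edges G. v' \<in> ends G d} = {}"
    using assms(1,4) by (auto simp: is_graph_def)
  have slack': "slack ?G' z w = slack G z w" "slack G v' w = 1" for z
    using no_edge unfolding slack_def by (simp, simp only: sum.empty)
  have "w \<in> matching_polytope ?G' \<longleftrightarrow> w \<in> matching_polytope G"
    by (auto simp: matching_polytope_iff_slack slack')
  moreover have "slack G v w \<le> 1" if "w \<in> matching_polytope G"
    using that by (auto simp: matching_polytope_iff_slack intro: slack_le_one)
  ultimately show ?thesis
    unfolding add_pendant_edge_def using assms fin
    by (subst fun_upd_in_matching_polytope_add_edge_iff) (auto simp: slack')
qed

lemma fiber_two_pendant_edges:
  assumes "is_graph H" "v\<^sub>1 \<in> verts H" "v\<^sub>2 \<in> verts H" "v\<^sub>1 \<noteq> v\<^sub>2"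
    and "v\<^sub>1' \<notin> verts H" "v\<^sub>2' \<notin> verts H" "v\<^sub>1' \<noteq> v\<^sub>2'"
    and "e\<^sub>1 \<notin> edges H" "e\<^sub>2 \<notin> edges H" "e\<^sub>1 \<noteq> e\<^sub>2"
    and "w \<in> extensional (edges H)"
  shows "w(e\<^sub>1 := x, e\<^sub>2 := y) \<in>
      matching_polytope (add_pendant_edge e\<^sub>2 v\<^sub>2 v\<^sub>2' (add_pendant_edge e\<^sub>1 v\<^sub>1 v\<^sub>1' H)) \<longleftrightarrow>
    w \<in> matching_polytope H \<and> x \<in> {0..slack H v\<^sub>1 w} \<and> y \<in> {0..slack H v\<^sub>2 w}"
proof -
  have "w(e\<^sub>1 := x) \<in> extensional (insert e\<^sub>1 (edges H))"
    using assms by (auto simp: extensional_def)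
  moreover have "v\<^sub>2 \<noteq> v\<^sub>1'" "finite (edges H)"
    using assms by (auto simp: is_graph_def)
  ultimately show ?thesis
    using assms
    by (auto simp: fun_upd_in_matching_polytope_add_pendant_edge_iff is_graph_add_pendant_edge
      slack_add_pendant_edge)
qed

text \<open>
  The weight \<open>z\<close> of the edge joining \<open>v\<close> and \<open>u\<close> is listed first, so that for fixed \<open>z\<close> the pendant
  weight \<open>x\<close> runs through an interval whose translate by \<open>z\<close> ends at the slack of \<open>v\<close>. The bound
  \<open>z \<le> slack H v w\<close> is implied by the nonemptiness of that interval.
\<close>
lemma fiber_pendant_edge_and_edge:
  assumes "is_graph H" "v \<in> verts H" "u \<in> verts H" "v \<noteq> u" "v' \<notin> verts H"
    and "e \<notin> edges H" "f \<notin> edges H" "e \<noteq> f"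
    and "w \<in> extensional (edges H)"
  shows "w(f := z, e := x) \<in> matching_polytope (add_edge f v u (add_pendant_edge e v v' H)) \<longleftrightarrow>
    w \<in> matching_polytope H \<and> z \<in> {0..slack H u w} \<and> x \<in> {0..slack H v w - z}"
proof -
  have "w(e := x) \<in> extensional (insert e (edges H))"
    using assms by (auto simp: extensional_def)
  moreover have "u \<noteq> v'" "v \<noteq> v'" "finite (edges H)"
    using assms by (auto simp: is_graph_def)
  moreover have "w(f := z, e := x) = w(e := x, f := z)"
    using assms by (simp add: fun_upd_twist)
  ultimately show ?thesis
    using assms
    by (auto simp: fun_upd_in_matching_polytope_add_pendant_edge_iff
      fun_upd_in_matching_polytope_add_edge_iff slack_add_pendant_edge)
qed

section \<open>Cutting a rectangle along its diagonal\<close>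

text \<open>
  On slices a shear is a translation, so it suffices to replace the interval from \<open>0\<close> to \<open>c - z\<close>
  by that from \<open>z\<close> to \<open>c\<close>. The two sheared regions are then the parts of the rectangle on the two
  sides of the diagonal. The identity also covers negative \<open>a\<close> or \<open>b\<close>, where all three areas are
  zero.
\<close>
lemma area_rectangle_eq_sheared_triangles:
  fixes a b :: real
  shows "(\<integral>\<^sup>+x. \<integral>\<^sup>+y. indicator {0..a} x * indicator {0..b} y \<partial>lborel \<partial>lborel) =
    (\<integral>\<^sup>+z. \<integral>\<^sup>+x. indicator {0..b} z * indicator {0..a - z} x \<partial>lborel \<partial>lborel) +
    (\<integral>\<^sup>+z. \<integral>\<^sup>+y. indicator {0..a} z * indicator {0..b - z} y \<partial>lborel \<partial>lborel)"
    (is "?R = ?T + ?T'")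
proof -
  let ?len = "emeasure lborel :: real set \<Rightarrow> ennreal"
  have meas [measurable]: "(\<lambda>y. ?len {y..a}) \<in> borel_measurable borel"
      "(\<lambda>y. ?len {0..min a y}) \<in> borel_measurable borel"
    unfolding emeasure_lborel_Icc_eq by measurable
  have shear: "?len {0..c - z} = ?len {z..c}" for c z :: real
    by (simp add: emeasure_lborel_Icc_eq)
  have T: "?T = (\<integral>\<^sup>+y. indicator {0..b} y * ?len {y..a} \<partial>lborel)"
    by (simp add: nn_integral_cmult shear)
  have "?T' = (\<integral>\<^sup>+x. \<integral>\<^sup>+y. indicator {0..a} x * indicator {x..b} y \<partial>lborel \<partial>lborel)"
    by (simp add: nn_integral_cmult shear)
  also have "\<dots> = (\<integral>\<^sup>+y. \<integral>\<^sup>+x. indicator {0..a} x * indicator {x..b} y \<partial>lborel \<partial>lborel)"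
  proof (rule lborel_pair.Fubini')
    have "(\<lambda>(y, x). indicator {0..a} x * indicator {x..b} y :: ennreal) =
        indicator {(y, x). 0 \<le> x \<and> x \<le> a \<and> x \<le> y \<and> y \<le> b}"
      by (auto simp: fun_eq_iff indicator_def)
    then show "(\<lambda>(y, x). indicator {0..a} x * indicator {x..b} y :: ennreal)
        \<in> borel_measurable (lborel \<Otimes>\<^sub>M lborel)"
      by simp
  qed
  also have "\<dots> = (\<integral>\<^sup>+y. \<integral>\<^sup>+x. indicator {0..b} y * indicator {0..min a y} x \<partial>lborel \<partial>lborel)"
    by (intro nn_integral_cong) (auto simp: indicator_def)
  also have "\<dots> = (\<integral>\<^sup>+y. indicator {0..b} y * ?len {0..min a y} \<partial>lborel)"
    by (simp add: nn_integral_cmult)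
  finally have T': "?T' = (\<integral>\<^sup>+y. indicator {0..b} y * ?len {0..min a y} \<partial>lborel)" .
  \<comment> \<open>The horizontal line at height \<open>y\<close> meets the rectangle in a segment cut by the diagonal at \<open>y\<close>;
    the minimum takes care of lines above the diagonal's exit through the right-hand side.\<close>
  have split: "indicator {0..b} y * (?len {y..a} + ?len {0..min a y}) = indicator {0..b} y * ?len {0..a}"
    for y
    by (auto simp: indicator_def emeasure_lborel_Icc_eq min_def simp flip: ennreal_plus)
  have "?T + ?T' = (\<integral>\<^sup>+y. indicator {0..b} y * (?len {y..a} + ?len {0..min a y}) \<partial>lborel)"
    unfolding T T' by (simp add: distrib_left nn_integral_add)
  also have "\<dots> = ?len {0..b} * ?len {0..a}"
    unfolding split by (simp add: nn_integral_multc del: emeasure_lborel_Icc)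
  also have "\<dots> = ?R"
    by (simp add: nn_integral_cmult nn_integral_multc mult.commute)
  finally show ?thesis ..
qed

section \<open>Volumes as iterated integrals\<close>

lemma sets_matching_polytope:
  assumes "finite (edges G)" "finite (verts G)"
  shows "matching_polytope G \<in> sets (\<Pi>\<^sub>M e\<in>edges G. lborel)"
proof -
  have [measurable]: "slack G v \<in> borel_measurable (\<Pi>\<^sub>M e\<in>edges G. lborel)" for v
    unfolding slack_def by measurable
  have "matching_polytope G = {w \<in> space (\<Pi>\<^sub>M e\<in>edges G. lborel).
      (\<forall>e\<in>edges G. 0 \<le> w e) \<and> (\<forall>v\<in>verts G. 0 \<le> slack G v w)}"
    by (auto simp: matching_polytope_iff_slack space_PiM PiE_iff)
  also have "\<dots> \<in> sets (\<Pi>\<^sub>M e\<in>edges G. lborel)"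
    using assms by measurable
  finally show ?thesis .
qed

text \<open>
  The capacity of an end point of an edge bounds the weight of that edge by \<open>1\<close>, so the polytope
  lies in the unit cube. Finiteness is what allows additivity of extended volumes to be read as
  additivity of real ones.
\<close>
lemma emeasure_matching_polytope_le_one:
  assumes "is_graph G"
  shows "emeasure (\<Pi>\<^sub>M e\<in>edges G. lborel) (matching_polytope G) \<le> 1"
proof -
  interpret product_sigma_finite "\<lambda>_ :: 'b. lborel :: real measure" ..
  have fin: "finite (edges G)"
    using assms by (simp add: is_graph_def)
  have "w e \<le> 1" if w: "w \<in> matching_polytope G" and e: "e \<in> edges G" for w e
  proof -
    obtain v where v: "v \<in> ends G e" "v \<in> verts G"
      using assms e unfolding is_graph_def by (metis card.empty ex_in_conv subsetD zero_neq_numeral)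
    have "w e \<le> (\<Sum>d\<in>{d\<in>edges G. v \<in> ends G d}. w d)"
      using w e v fin by (intro member_le_sum) (auto simp: matching_polytope_def PiE_iff)
    also have "\<dots> \<le> 1"
      using w v by (simp add: matching_polytope_def)
    finally show ?thesis .
  qed
  then have "matching_polytope G \<subseteq> (\<Pi>\<^sub>E e\<in>edges G. {0..1})"
    by (auto simp: matching_polytope_def PiE_iff extensional_def)
  then have "emeasure (\<Pi>\<^sub>M e\<in>edges G. lborel) (matching_polytope G) \<le>
      emeasure (\<Pi>\<^sub>M e\<in>edges G. lborel) (\<Pi>\<^sub>E e\<in>edges G. {0..1 :: real})"
    by (rule emeasure_mono) (use fin in \<open>simp add: sets_PiM_I_finite\<close>)
  also have "\<dots> = 1"
    using fin by (simp add: emeasure_PiM)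
  finally show ?thesis .
qed

text \<open>
  Tonelli's theorem with two coordinates split off. Measurability of the fiber area as a function
  of the base point is recorded as well, since splitting the integral of a sum of fiber areas
  depends on it.
\<close>
lemma emeasure_PiM_insert_insert:
  fixes E :: "'e set" and A :: "('e \<Rightarrow> real) set"
  assumes "finite E" "p \<notin> E" "q \<notin> E" "p \<noteq> q"
    and A [measurable]: "A \<in> sets (PiM (insert q (insert p E)) (\<lambda>_. lborel))"
  defines "J \<equiv> \<lambda>w. \<integral>\<^sup>+x. \<integral>\<^sup>+y. indicator A (w(p := x, q := y)) \<partial>lborel \<partial>lborel"
  shows emeasure_PiM_insert_insert_eq:
      "emeasure (PiM (insert q (insert p E)) (\<lambda>_. lborel)) A = (\<integral>\<^sup>+w. J w \<partial>PiM E (\<lambda>_. lborel))"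
    and borel_measurable_fiber_PiM_insert_insert:
      "J \<in> borel_measurable (PiM E (\<lambda>_. lborel))"
proof -
  interpret product_sigma_finite "\<lambda>_ :: 'e. lborel :: real measure" ..
  let ?K = "\<lambda>w. \<integral>\<^sup>+y. indicator A (w(q := y)) \<partial>lborel"
  have K [measurable]: "?K \<in> borel_measurable (PiM (insert p E) (\<lambda>_. lborel))"
    by measurable
  show "J \<in> borel_measurable (PiM E (\<lambda>_. lborel))"
    unfolding J_def by measurable
  have "emeasure (PiM (insert q (insert p E)) (\<lambda>_. lborel)) A =
      (\<integral>\<^sup>+w. indicator A w \<partial>PiM (insert q (insert p E)) (\<lambda>_. lborel))"
    by simp
  also have "\<dots> = (\<integral>\<^sup>+w. ?K w \<partial>PiM (insert p E) (\<lambda>_. lborel))"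
    using assms by (intro product_nn_integral_insert) auto
  also have "\<dots> = (\<integral>\<^sup>+w. J w \<partial>PiM E (\<lambda>_. lborel))"
    unfolding J_def using assms by (intro product_nn_integral_insert) auto
  finally show "emeasure (PiM (insert q (insert p E)) (\<lambda>_. lborel)) A =
      (\<integral>\<^sup>+w. J w \<partial>PiM E (\<lambda>_. lborel))" .
qed

section \<open>The leaf recurrence\<close>

theorem proposition2p4:
  fixes H G G\<^sub>1 G\<^sub>2 :: "('v, 'e) graph"
    and v\<^sub>1 v\<^sub>2 v\<^sub>1' v\<^sub>2' :: 'v
    and e\<^sub>1 e\<^sub>2 f :: 'e
  assumes "is_graph H"
    and "v\<^sub>1 \<in> verts H" and "v\<^sub>2 \<in> verts H" and "v\<^sub>1 \<noteq> v\<^sub>2"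
    and "v\<^sub>1' \<notin> verts H" and "v\<^sub>2' \<notin> verts H" and "v\<^sub>1' \<noteq> v\<^sub>2'"
    and "e\<^sub>1 \<notin> edges H" and "e\<^sub>2 \<notin> edges H" and "f \<notin> edges H" and "distinct [e\<^sub>1, e\<^sub>2, f]"
    and "G = add_pendant_edge e\<^sub>2 v\<^sub>2 v\<^sub>2' (add_pendant_edge e\<^sub>1 v\<^sub>1 v\<^sub>1' H)"
    and "G\<^sub>1 = add_edge f v\<^sub>1 v\<^sub>2 (add_pendant_edge e\<^sub>1 v\<^sub>1 v\<^sub>1' H)"
    and "G\<^sub>2 = add_edge f v\<^sub>1 v\<^sub>2 (add_pendant_edge e\<^sub>2 v\<^sub>2 v\<^sub>2' H)"
    and "bipartite G" and "bipartite G\<^sub>1" and "bipartite G\<^sub>2"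
  shows "normalized_volume G = normalized_volume G\<^sub>1 + normalized_volume G\<^sub>2"
proof -
  let ?vol = "\<lambda>K :: ('v, 'e) graph. emeasure (\<Pi>\<^sub>M e\<in>edges K. lborel) (matching_polytope K)"
  let ?E = "edges H"
  \<comment> \<open>The area of the fiber of the polytope of \<open>K\<close> over \<open>w\<close>, the edges \<open>p\<close> and \<open>q\<close> being new.\<close>
  define J where "J = (\<lambda>(K :: ('v, 'e) graph) p q w.
    \<integral>\<^sup>+x. \<integral>\<^sup>+y. indicator (matching_polytope K) (w(p := x, q := y)) \<partial>lborel \<partial>lborel :: ennreal)"
  have fin: "finite ?E"
    using assms(1) by (simp add: is_graph_def)
  have distinct: "e\<^sub>1 \<noteq> e\<^sub>2" "e\<^sub>1 \<noteq> f" "e\<^sub>2 \<noteq> f"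
    using assms(11) by auto
  have leaf: "v\<^sub>1' \<noteq> v\<^sub>2" "v\<^sub>2' \<noteq> v\<^sub>1"
    using assms by auto
  \<comment> \<open>Reversing the new edge makes \<open>G\<^sub>2\<close> the mirror image of \<open>G\<^sub>1\<close>, so one fiber lemma serves both.\<close>
  have G\<^sub>2_swap: "G\<^sub>2 = add_edge f v\<^sub>2 v\<^sub>1 (add_pendant_edge e\<^sub>2 v\<^sub>2 v\<^sub>2' H)"
    using assms(14) by (simp add: add_edge_commute)
  have graph: "is_graph G" "is_graph G\<^sub>1" "is_graph G\<^sub>2"
    using assms leaf by (auto intro!: is_graph_add_edge is_graph_add_pendant_edge)
  have edges: "edges G = insert e\<^sub>2 (insert e\<^sub>1 ?E)" "edges G\<^sub>1 = insert e\<^sub>1 (insert f ?E)"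
      "edges G\<^sub>2 = insert e\<^sub>2 (insert f ?E)"
    using assms(12-14) by auto
  have vol: "?vol K = (\<integral>\<^sup>+w. J K p q w \<partial>PiM ?E (\<lambda>_. lborel))"
    and meas: "J K p q \<in> borel_measurable (PiM ?E (\<lambda>_. lborel))"
    if "is_graph K" "edges K = insert q (insert p ?E)" "p \<notin> ?E" "q \<notin> ?E" "p \<noteq> q" for K p q
  proof -
    have A: "matching_polytope K \<in> sets (PiM (insert q (insert p ?E)) (\<lambda>_. lborel))"
      using sets_matching_polytope[of K] that by (auto simp: is_graph_def)
    show "?vol K = (\<integral>\<^sup>+w. J K p q w \<partial>PiM ?E (\<lambda>_. lborel))"
      unfolding J_def using emeasure_PiM_insert_insert_eq[OF fin that(3-5) A] that(2) by simp
    show "J K p q \<in> borel_measurable (PiM ?E (\<lambda>_. lborel))"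
      unfolding J_def by (rule borel_measurable_fiber_PiM_insert_insert[OF fin that(3-5) A])
  qed
  have fiber: "J G e\<^sub>1 e\<^sub>2 w = J G\<^sub>1 f e\<^sub>1 w + J G\<^sub>2 f e\<^sub>2 w"
    if "w \<in> extensional ?E" for w
  proof -
    have mem_G: "w(e\<^sub>1 := x, e\<^sub>2 := y) \<in> matching_polytope G \<longleftrightarrow>
        w \<in> matching_polytope H \<and> x \<in> {0..slack H v\<^sub>1 w} \<and> y \<in> {0..slack H v\<^sub>2 w}" for x y
      unfolding assms(12) using assms(1-10) distinct that by (intro fiber_two_pendant_edges) auto
    have mem_G\<^sub>1: "w(f := x, e\<^sub>1 := y) \<in> matching_polytope G\<^sub>1 \<longleftrightarrow>
        w \<in> matching_polytope H \<and> x \<in> {0..slack H v\<^sub>2 w} \<and> y \<in> {0..slack H v\<^sub>1 w - x}" for x y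
      unfolding assms(13) using assms(1-10) distinct that
      by (intro fiber_pendant_edge_and_edge) auto
    have mem_G\<^sub>2: "w(f := x, e\<^sub>2 := y) \<in> matching_polytope G\<^sub>2 \<longleftrightarrow>
        w \<in> matching_polytope H \<and> x \<in> {0..slack H v\<^sub>1 w} \<and> y \<in> {0..slack H v\<^sub>2 w - x}" for x y
      unfolding G\<^sub>2_swap using assms(1-10) distinct that
      by (intro fiber_pendant_edge_and_edge) auto
    have "indicator (matching_polytope G) (w(e\<^sub>1 := x, e\<^sub>2 := y)) =
        (indicator (matching_polytope H) w *
          (indicator {0..slack H v\<^sub>1 w} x * indicator {0..slack H v\<^sub>2 w} y) :: ennreal)"
      and "indicator (matching_polytope G\<^sub>1) (w(f := x, e\<^sub>1 := y)) =
        (indicator (matching_polytope H) w *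
          (indicator {0..slack H v\<^sub>2 w} x * indicator {0..slack H v\<^sub>1 w - x} y) :: ennreal)"
      and "indicator (matching_polytope G\<^sub>2) (w(f := x, e\<^sub>2 := y)) =
        (indicator (matching_polytope H) w *
          (indicator {0..slack H v\<^sub>1 w} x * indicator {0..slack H v\<^sub>2 w - x} y) :: ennreal)"
      for x y
      unfolding indicator_def mem_G mem_G\<^sub>1 mem_G\<^sub>2 by auto
    then show ?thesis
      unfolding J_def
      using area_rectangle_eq_sheared_triangles[of "slack H v\<^sub>1 w" "slack H v\<^sub>2 w"]
      by (cases "w \<in> matching_polytope H") simp_all
  qed
  have "?vol G = (\<integral>\<^sup>+w. J G e\<^sub>1 e\<^sub>2 w \<partial>PiM ?E (\<lambda>_. lborel))"
    using assms distinct graph edges by (intro vol) auto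
  also have "\<dots> = (\<integral>\<^sup>+w. J G\<^sub>1 f e\<^sub>1 w + J G\<^sub>2 f e\<^sub>2 w \<partial>PiM ?E (\<lambda>_. lborel))"
    by (intro nn_integral_cong fiber) (auto simp: space_PiM PiE_iff)
  also have "\<dots> = (\<integral>\<^sup>+w. J G\<^sub>1 f e\<^sub>1 w \<partial>PiM ?E (\<lambda>_. lborel)) +
      (\<integral>\<^sup>+w. J G\<^sub>2 f e\<^sub>2 w \<partial>PiM ?E (\<lambda>_. lborel))"
    using assms distinct graph edges by (intro nn_integral_add meas) auto
  also have "\<dots> = ?vol G\<^sub>1 + ?vol G\<^sub>2"
    using assms distinct graph edges by (intro arg_cong2[where f = "(+)"] vol[symmetric]) auto
  finally have "?vol G = ?vol G\<^sub>1 + ?vol G\<^sub>2" .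
  moreover have "?vol K < top" if "is_graph K" for K
    using emeasure_matching_polytope_le_one[OF that] by (rule le_less_trans) simp
  ultimately have "measure (\<Pi>\<^sub>M e\<in>edges G. lborel) (matching_polytope G) =
      measure (\<Pi>\<^sub>M e\<in>edges G\<^sub>1. lborel) (matching_polytope G\<^sub>1) +
      measure (\<Pi>\<^sub>M e\<in>edges G\<^sub>2. lborel) (matching_polytope G\<^sub>2)"
    using graph by (simp add: measure_def enn2real_plus)
  moreover have "card (edges G\<^sub>1) = card (edges G)" "card (edges G\<^sub>2) = card (edges G)"
    using fin assms(8-10) distinct by (simp_all add: edges)
  ultimately show ?thesis
    by (simp add: normalized_volume_def distrib_left)
qed

end
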